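(* Let $w$ be a bi-infinite word over a finite alphabet $\mathcal{A}$. Let $\Theta_w$ be its associated subshift of $\mathcal{A}^{\mathbb{Z}}$, $\Omega_w$ the suspension of $(\Theta_w,\tau)$, and $(R_n)_{n\in\mathbb{N}}$ the Rauzy graphs of $w$ with the maps $\gamma_n : R_{n+1}\to R_n$. Then there is a homeomorphism $$\Omega_w \simeq \varprojlim (R_n,\gamma_n)_{n\in\mathbb{N}} .$$
   Context: $\mathbb{N}=\{1,2,\dots\}$. $\mathcal{A}^{\mathbb{Z}}$ has the product topology, and the shift $\tau$ is given by $\tau(x)_i=x_{i+1}$. Subshift: $\Theta_w$ is the closure in $\mathcal{A}^{\mathbb{Z}}$ of $\{\tau^n(w): n\in\mathbb{Z}\}$. Suspension: $\Omega_w=\Theta_w\times\mathbb{R}/\sim$, where $\sim$ is generated by $(x,t)\sim(\tau(x),t-1)$; a basis of open sets is given by $U(V,I)=\{[(x,t)]: x\in V,\ t\in I\}$ with $V\subseteq\Theta_w$ open and $I\subseteq\mathbb{R}$ an open interval. Rauzy graphs: $F_n(w)$ is the set of finite subwords (factors) of $w$ of length $n$. $R_n$ is the oriented graph with vertex set $V_n=F_n(w)$, with an edge from $a_1\dots a_n$ to $b_1\dots b_n$ if $a_i=b_{i-1}$ for $2\le i\le n$ and $a_1\dots a_nb_n$ is a factor of $w$; there is at most one edge from a given vertex to another given vertex. $R_n$ is regarded as a metric (topological) space: the disjoint union over the edges of copies of $[0,1]$, with vertices glued according to adjacency. Maps $\gamma_n:R_{n+1}\to R_n$: on vertices, $\gamma_n(a_1\dots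 a_{n+1})=a_1\dots a_n$ if $n$ is even, and $\gamma_n(a_1\dots a_{n+1})=a_2\dots a_{n+1}$ if $n$ is odd. If an edge $e$ of $R_{n+1}$ goes from $a$ to $b$, there is an edge of $R_n$ from $\gamma_n(a)$ to $\gamma_n(b)$, and $\gamma_n$ maps $e$ to that edge by the identity of $[0,1]$. These maps are continuous. Inverse limit: $\varprojlim(R_n,\gamma_n)_{n\in\mathbb{N}}=\{(x_1,x_2,\dots)\in\prod_{n\in\mathbb{N}}R_n:\ \gamma_n(x_{n+1})=x_n\ \forall n\in\mathbb{N}\}$ with the topology induced by the product topology. *)

theory Defs
  imports "HOL-Analysis.Analysis"
begin

section \<open>Quotient spaces\<close>

definition eq_class :: "('a \<Rightarrow> 'a \<Rightarrow> bool) \<Rightarrow> 'a \<Rightarrow> 'a set" where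
  "eq_class r x = {y. equivclp r x y}"

text \<open>The quotient of a space by the equivalence relation generated by \<open>r\<close>.  In all uses below
  \<open>r\<close> only relates points of \<open>topspace X\<close>, so that the classes are subsets of \<open>topspace X\<close>.\<close>

definition quotient_space :: "'a topology \<Rightarrow> ('a \<Rightarrow> 'a \<Rightarrow> bool) \<Rightarrow> 'a set topology" where
  "quotient_space X r = topology (\<lambda>U. U \<subseteq> eq_class r ` topspace X \<and>
      openin X {x \<in> topspace X. eq_class r x \<in> U})"

lemma openin_quotient_space:
  "openin (quotient_space X r) U \<longleftrightarrow>
     U \<subseteq> eq_class r ` topspace X \<and> openin X {x \<in> topspace X. eq_class r x \<in> U}"
proof -
  have "istopology (\<lambda>U. U \<subseteq> eq_class r ` topspace X \<and>
      openin X {x \<in> topspace X. eq_class r x \<in> U})" (is "istopology ?P")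
    unfolding istopology_def
  proof (intro conjI allI impI)
    fix S T assume "?P S" "?P T"
    moreover have "{x \<in> topspace X. eq_class r x \<in> S \<inter> T} =
      {x \<in> topspace X. eq_class r x \<in> S} \<inter> {x \<in> topspace X. eq_class r x \<in> T}" by auto
    ultimately show "S \<inter> T \<subseteq> eq_class r ` topspace X"
      and "openin X {x \<in> topspace X. eq_class r x \<in> S \<inter> T}" by auto
  next
    fix K assume K: "\<forall>S\<in>K. ?P S"
    then show "\<Union>K \<subseteq> eq_class r ` topspace X" by blast
    have "{x \<in> topspace X. eq_class r x \<in> \<Union>K} =
      \<Union>((\<lambda>S. {x \<in> topspace X. eq_class r x \<in> S}) ` K)" by auto
    also have "openin X \<dots>" using K by (intro openin_Union) auto
    finally show "openin X {x \<in> topspace X. eq_class r x \<in> \<Union>K}" .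
  qed
  then show ?thesis by (simp add: quotient_space_def)
qed

lemma topspace_quotient_space [simp]:
  "topspace (quotient_space X r) = eq_class r ` topspace X"
proof -
  have "{x \<in> topspace X. eq_class r x \<in> eq_class r ` topspace X} = topspace X" by auto
  then have "openin (quotient_space X r) (eq_class r ` topspace X)"
    by (simp add: openin_quotient_space)
  then show ?thesis
    by (meson openin_quotient_space openin_subset openin_topspace subset_antisym)
qed

lemma quotient_map_eq_class: "quotient_map X (quotient_space X r) (eq_class r)"
  by (auto simp: quotient_map_def openin_quotient_space)

lemma eq_class_eq_iff: "eq_class r x = eq_class r y \<longleftrightarrow> equivclp r x y"
  unfolding eq_class_def by (auto intro: equivclp_trans equivclp_sym)

lemma equivclp_respects:
  assumes "equivclp r x y" and "\<And>x y. r x y \<Longrightarrow> equivclp r' (f x) (f y)"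
  shows "equivclp r' (f x) (f y)"
  using assms(1)
proof (induction rule: equivclp_induct)
  case base
  show ?case by simp
next
  case (step y z)
  then show ?case by (meson assms(2) equivclp_sym equivclp_trans)
qed


section \<open>The subshift of a bi-infinite word\<close>

definition shift :: "(int \<Rightarrow> 'a) \<Rightarrow> int \<Rightarrow> 'a" where
  "shift x = (\<lambda>i. x (i + 1))"

definition shift_power :: "int \<Rightarrow> (int \<Rightarrow> 'a) \<Rightarrow> int \<Rightarrow> 'a" where
  "shift_power n x = (\<lambda>i. x (i + n))"

lemma shift_power_of_nat: "shift_power (int n) = shift ^^ n"
proof (induction n)
  case 0
  show ?case by (simp add: shift_power_def fun_eq_iff)
next
  case (Suc n)
  have "shift_power (int (Suc n)) x = shift ((shift ^^ n) x)" for x :: "int \<Rightarrow> 'a"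
    by (simp add: Suc.IH [symmetric] shift_power_def shift_def algebra_simps)
  then show ?case by (simp add: fun_eq_iff)
qed

lemma shift_power_add: "shift_power m (shift_power n x) = shift_power (m + n) x"
  by (simp add: shift_power_def algebra_simps)

lemma shift_power_uminus: "shift_power (- int n) = inv (shift ^^ n)"
proof -
  have "shift_power (int n) (shift_power (- int n) x) = x"
    and "shift_power (- int n) (shift_power (int n) x) = x" for x :: "int \<Rightarrow> 'a"
    by (simp_all add: shift_power_def)
  then show ?thesis
    unfolding shift_power_of_nat [symmetric]
    by (intro inv_equality [symmetric]) auto
qed

definition full_shift :: "'a set \<Rightarrow> (int \<Rightarrow> 'a) topology" where
  "full_shift A = product_topology (\<lambda>_. discrete_topology A) UNIV"

definition subshift :: "'a set \<Rightarrow> (int \<Rightarrow> 'a) \<Rightarrow> (int \<Rightarrow> 'a) topology" where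
  "subshift A w = subtopology (full_shift A)
      (full_shift A closure_of {shift_power n w | n. True})"

lemma topspace_subshift:
  "topspace (subshift A w) = full_shift A closure_of {shift_power n w | n. True}"
  by (simp add: subshift_def closure_of_subset_topspace inf_absorb2)

lemma homeomorphic_maps_shift_power_full_shift:
  "homeomorphic_maps (full_shift A) (full_shift A) (shift_power n) (shift_power (- n))"
proof -
  have "continuous_map (full_shift A) (full_shift A) (shift_power k)" for k
    unfolding full_shift_def continuous_map_componentwise_UNIV shift_power_def
    by (intro allI continuous_map_product_projection) simp
  moreover have "shift_power (- n) (shift_power n x) = x" "shift_power n (shift_power (- n) x) = x"
    for x :: "int \<Rightarrow> 'a"
    by (simp_all add: shift_power_def)
  ultimately show ?thesis
    unfolding homeomorphic_maps_def by auto
qed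

lemma homeomorphic_maps_shift_subshift:
  "homeomorphic_maps (subshift A w) (subshift A w) shift (shift_power (- 1))"
proof -
  let ?O = "{shift_power n w | n. True}"
  have hm: "homeomorphic_maps (full_shift A) (full_shift A) (shift_power k) (shift_power (- k))"
    for k by (rule homeomorphic_maps_shift_power_full_shift)
  have cm: "continuous_map (full_shift A) (full_shift A) (shift_power k)" for k
    using hm[of k] by (simp add: homeomorphic_maps_def)
  have "shift_power k ` (full_shift A closure_of ?O) \<subseteq> full_shift A closure_of ?O" for k
  proof -
    have "shift_power k ` (full_shift A closure_of ?O) \<subseteq>
        full_shift A closure_of (shift_power k ` ?O)"
      using cm by (rule continuous_map_image_closure_subset)
    also have "\<dots> \<subseteq> full_shift A closure_of ?O"
      by (rule closure_of_mono) (auto simp: shift_power_add)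
    finally show ?thesis .
  qed
  then have c: "continuous_map (subshift A w) (subshift A w) (shift_power k)" for k
    unfolding subshift_def
    using cm by (auto simp: continuous_map_in_subtopology continuous_map_from_subtopology)
  have "shift = (shift_power 1 :: (int \<Rightarrow> 'a) \<Rightarrow> _)"
    by (simp add: shift_def shift_power_def fun_eq_iff)
  then show ?thesis
    using c[of 1] c[of "- 1"]
    by (simp add: homeomorphic_maps_def shift_power_add) (simp add: shift_power_def shift_def)
qed


section \<open>Suspensions\<close>

definition suspension_step ::
    "'a topology \<Rightarrow> ('a \<Rightarrow> 'a) \<Rightarrow> 'a \<times> real \<Rightarrow> 'a \<times> real \<Rightarrow> bool" where
  "suspension_step X f = (\<lambda>(x, t) q. x \<in> topspace X \<and> q = (f x, t - 1))"

definition suspension :: "'a topology \<Rightarrow> ('a \<Rightarrow> 'a) \<Rightarrow> ('a \<times> real) set topology" where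
  "suspension X f = quotient_space (prod_topology X euclideanreal) (suspension_step X f)"

definition suspension_box ::
    "'a topology \<Rightarrow> ('a \<Rightarrow> 'a) \<Rightarrow> 'a set \<Rightarrow> real set \<Rightarrow> ('a \<times> real) set set" where
  "suspension_box X f V I = {eq_class (suspension_step X f) (x, t) | x t. x \<in> V \<and> t \<in> I}"

lemma suspension_equiv_open_nbhd:
  assumes fg: "homeomorphic_maps X X f g"
    and "equivclp (suspension_step X f) p q"
    and "p \<in> topspace (prod_topology X euclideanreal)"
    and "openin (prod_topology X euclideanreal) W" "q \<in> W"
  shows "\<exists>W'. openin (prod_topology X euclideanreal) W' \<and> p \<in> W' \<and>
           (\<forall>p'\<in>W'. \<exists>q'\<in>W. equivclp (suspension_step X f) p' q')"
  using assms(2,4,5)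
proof (induction arbitrary: W rule: equivclp_induct)
  case base
  then show ?case by (meson equivclp_refl)
next
  case (step y z)
  let ?P = "prod_topology X euclideanreal" and ?r = "suspension_step X f"
  let ?F = "\<lambda>p. (f (fst p), snd p - 1 :: real)" and ?G = "\<lambda>p. (g (fst p), snd p + 1 :: real)"
  have cf: "continuous_map X X f" and cg: "continuous_map X X g"
    and gf: "\<And>x. x \<in> topspace X \<Longrightarrow> g (f x) = x" and fg': "\<And>x. x \<in> topspace X \<Longrightarrow> f (g x) = x"
    using fg by (auto simp: homeomorphic_maps_def)
  have cF: "continuous_map ?P ?P ?F"
    by (intro continuous_map_pairedI continuous_map_compose[OF continuous_map_fst cf, unfolded o_def]
        continuous_intros continuous_map_snd)
  have cG: "continuous_map ?P ?P ?G"
    by (intro continuous_map_pairedI continuous_map_compose[OF continuous_map_fst cg, unfolded o_def]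
        continuous_intros continuous_map_snd)
  obtain H where cH: "continuous_map ?P ?P H" and H: "H y = z" "y \<in> topspace ?P"
    and Hr: "\<And>p. p \<in> topspace ?P \<Longrightarrow> equivclp ?r p (H p)"
  proof (cases "?r y z")
    case True
    moreover have "equivclp ?r p (?F p)" if "p \<in> topspace ?P" for p
      using that by (intro r_into_equivclp) (auto simp: suspension_step_def case_prod_unfold)
    ultimately show ?thesis
      using that[OF cF] by (auto simp: suspension_step_def case_prod_unfold mem_Times_iff)
  next
    case False
    then have zy: "?r z y" using step by blast
    have "equivclp ?r p (?G p)" if p: "p \<in> topspace ?P" for p
    proof (rule equivclp_sym, rule r_into_equivclp)
      have "g (fst p) \<in> topspace X"
        using p cg by (auto simp: continuous_map_def mem_Times_iff)
      then show "?r (?G p) p"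
        using p fg' by (auto simp: suspension_step_def case_prod_unfold mem_Times_iff prod_eq_iff)
    qed
    moreover have "f (fst z) \<in> topspace X"
      using zy cf by (auto simp: suspension_step_def case_prod_unfold continuous_map_def)
    ultimately show ?thesis
      using that[OF cG] zy gf by (auto simp: suspension_step_def case_prod_unfold mem_Times_iff prod_eq_iff)
  qed
  have "openin ?P {p \<in> topspace ?P. H p \<in> W}"
    using cH step.prems(1) by (rule openin_continuous_map_preimage)
  moreover have "y \<in> {p \<in> topspace ?P. H p \<in> W}"
    using H step.prems(2) by simp
  ultimately obtain W' where W': "openin ?P W'" "p \<in> W'"
    and *: "\<forall>p'\<in>W'. \<exists>q'\<in>{p \<in> topspace ?P. H p \<in> W}. equivclp ?r p' q'"
    using step.IH by blast
  have "\<exists>q'\<in>W. equivclp ?r p' q'" if "p' \<in> W'" for p'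
    using * that Hr by (blast intro: equivclp_trans)
  then show ?case using W' by blast
qed

text \<open>The sets \<open>U(V,I)\<close> with \<open>V\<close> open and \<open>I\<close> an open interval form a basis of the suspension.\<close>

lemma suspension_base:
  assumes fg: "homeomorphic_maps X X f g"
  shows "openin (suspension X f) =
    arbitrary union_of (\<lambda>U. \<exists>V I. openin X V \<and> open I \<and> is_interval I \<and> U = suspension_box X f V I)"
proof -
  let ?P = "prod_topology X euclideanreal" and ?r = "suspension_step X f"
  have box: "openin (suspension X f) (suspension_box X f V I)" if V: "openin X V" and I: "open I"
    for V I
    unfolding suspension_def openin_quotient_space
  proof
    show "suspension_box X f V I \<subseteq> eq_class ?r ` topspace ?P"
      using openin_subset[OF V] by (auto simp: suspension_box_def)
    show "openin ?P {x \<in> topspace ?P. eq_class ?r x \<in> suspension_box X f V I}"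
    proof (subst openin_subopen, safe)
      fix x t assume xt: "(x, t) \<in> topspace ?P"
        and "eq_class ?r (x, t) \<in> suspension_box X f V I"
      then obtain y s where ys: "y \<in> V" "s \<in> I" "equivclp ?r (x, t) (y, s)"
        by (auto simp: suspension_box_def eq_class_eq_iff)
      have "openin ?P (V \<times> I)" using V I by (simp add: openin_prod_Times_iff)
      from suspension_equiv_open_nbhd[OF fg ys(3) xt this] ys(1,2)
      obtain W where W: "openin ?P W" "(x, t) \<in> W"
        "\<forall>p'\<in>W. \<exists>q'\<in>V \<times> I. equivclp ?r p' q'" by auto
      have "W \<subseteq> {x \<in> topspace ?P. eq_class ?r x \<in> suspension_box X f V I}"
      proof
        fix p assume p: "p \<in> W"
        then obtain y s where "y \<in> V" "s \<in> I" "equivclp ?r p (y, s)" using W(3) by blast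
        then have "eq_class ?r p \<in> suspension_box X f V I"
          by (auto simp: suspension_box_def eq_class_eq_iff)
        then show "p \<in> {x \<in> topspace ?P. eq_class ?r x \<in> suspension_box X f V I}"
          using p openin_subset[OF W(1)] by blast
      qed
      then show "\<exists>T. openin ?P T \<and> (x, t) \<in> T \<and>
          T \<subseteq> {x \<in> topspace ?P. eq_class ?r x \<in> suspension_box X f V I}"
        using W by blast
    qed
  qed
  have "\<exists>B. (\<exists>V I. openin X V \<and> open I \<and> is_interval I \<and> B = suspension_box X f V I) \<and>
        c \<in> B \<and> B \<subseteq> U"
    if U: "openin (suspension X f) U" and c: "c \<in> U" for U c
  proof -
    have Us: "U \<subseteq> eq_class ?r ` topspace ?P"
      and Uo: "openin ?P {p \<in> topspace ?P. eq_class ?r p \<in> U}"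
      using U by (simp_all add: suspension_def openin_quotient_space)
    obtain x t where xt: "c = eq_class ?r (x, t)" "(x, t) \<in> topspace ?P"
      using Us c by (metis imageE subsetD surj_pair)
    define Q where "Q = {p \<in> topspace ?P. eq_class ?r p \<in> U}"
    have "(x, t) \<in> Q" "openin ?P Q" using c xt Uo by (simp_all add: Q_def)
    then obtain V J where VJ: "openin X V" "open J" "x \<in> V" "t \<in> J" "V \<times> J \<subseteq> Q"
      using openin_prod_topology_alt[THEN iffD1, rule_format, of X euclideanreal Q x t]
      by (metis open_openin)
    obtain e where e: "e > 0" "ball t e \<subseteq> J" using VJ open_contains_ball by metis
    have "suspension_box X f V (ball t e) \<subseteq> U"
    proof
      fix d assume "d \<in> suspension_box X f V (ball t e)"
      then obtain y s where "d = eq_class ?r (y, s)" "(y, s) \<in> V \<times> J"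
        using e(2) by (auto simp: suspension_box_def)
      then show "d \<in> U" using VJ(5) unfolding Q_def by blast
    qed
    moreover have "c \<in> suspension_box X f V (ball t e)"
      using VJ(3) e(1) xt(1) unfolding suspension_box_def by (blast intro: centre_in_ball[THEN iffD2])
    moreover have "open (ball t e)" "is_interval (ball t e)"
      by (simp_all add: is_interval_convex_1)
    ultimately show ?thesis
      using VJ(1) by blast
  qed
  then show ?thesis
    unfolding openin_topology_base_unique using box by blast
qed


section \<open>Rauzy graphs\<close>

definition factors :: "(int \<Rightarrow> 'a) \<Rightarrow> nat \<Rightarrow> 'a list set" where
  "factors w n = {map (\<lambda>i. w (k + int i)) [0..<n] | k. True}"

text \<open>An edge is the pair of its source and target: there are no multiple edges.\<close>

definition rauzy_edges :: "(int \<Rightarrow> 'a) \<Rightarrow> nat \<Rightarrow> ('a list \<times> 'a list) set" where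
  "rauzy_edges w n = {(a, b). a \<in> factors w n \<and> b \<in> factors w n \<and>
      (\<forall>i\<in>{1..<n}. a ! i = b ! (i - 1)) \<and> a @ [last b] \<in> factors w (Suc n)}"

definition edge_end :: "'v \<times> 'v \<Rightarrow> real \<Rightarrow> 'v \<Rightarrow> bool" where
  "edge_end e t v \<longleftrightarrow> t = 0 \<and> v = fst e \<or> t = 1 \<and> v = snd e"

definition rauzy_glue :: "(int \<Rightarrow> 'a) \<Rightarrow> nat \<Rightarrow>
    ('a list \<times> 'a list) \<times> real \<Rightarrow> ('a list \<times> 'a list) \<times> real \<Rightarrow> bool" where
  "rauzy_glue w n p q \<longleftrightarrow> fst p \<in> rauzy_edges w n \<and> fst q \<in> rauzy_edges w n \<and>
      (\<exists>v. edge_end (fst p) (snd p) v \<and> edge_end (fst q) (snd q) v)"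

text \<open>Points of \<open>R\<^sub>n\<close> are classes of pairs of an edge and a parameter in \<open>[0,1]\<close>.  No vertex is
  lost in this way, since every vertex is the source of an edge (\<open>rauzy_edge_from\<close> below).\<close>

definition rauzy_space :: "(int \<Rightarrow> 'a) \<Rightarrow> nat \<Rightarrow> (('a list \<times> 'a list) \<times> real) set topology" where
  "rauzy_space w n = quotient_space
      (sum_topology (\<lambda>_. top_of_set {0..1}) (rauzy_edges w n)) (rauzy_glue w n)"

definition rauzy_vmap :: "nat \<Rightarrow> 'a list \<Rightarrow> 'a list" where
  "rauzy_vmap n a = (if even n then butlast a else tl a)"

definition rauzy_emap :: "nat \<Rightarrow> ('a list \<times> 'a list) \<times> real \<Rightarrow> ('a list \<times> 'a list) \<times> real" where
  "rauzy_emap n = (\<lambda>((a, b), t). ((rauzy_vmap n a, rauzy_vmap n b), t))"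

text \<open>The map \<open>\<gamma>\<^sub>n\<close> from \<open>R\<^sub>n\<^sub>+\<^sub>1\<close> to \<open>R\<^sub>n\<close>.  The union is over representatives \<open>p\<close> of the class \<open>C\<close>;
  all of them yield the same class, see \<open>rauzy_map_eq_class\<close>.\<close>

definition rauzy_map :: "(int \<Rightarrow> 'a) \<Rightarrow> nat \<Rightarrow>
    (('a list \<times> 'a list) \<times> real) set \<Rightarrow> (('a list \<times> 'a list) \<times> real) set" where
  "rauzy_map w n C = (\<Union>p\<in>C. eq_class (rauzy_glue w n) (rauzy_emap n p))"

lemma rauzy_edges_eq:
  assumes "n \<ge> 1"
  shows "rauzy_edges w n =
    {(map (\<lambda>i. w (k + int i)) [0..<n], map (\<lambda>i. w (k + 1 + int i)) [0..<n]) | k. True}"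
    (is "_ = ?R")
proof (intro subset_antisym subsetI)
  fix e assume "e \<in> rauzy_edges w n"
  then obtain a b where e: "e = (a, b)" and b: "b \<in> factors w n"
    and ab: "\<forall>i\<in>{1..<n}. a ! i = b ! (i - 1)" and abw: "a @ [last b] \<in> factors w (Suc n)"
    by (auto simp: rauzy_edges_def)
  from abw obtain k where k: "a @ [last b] = map (\<lambda>i. w (k + int i)) [0..<Suc n]"
    unfolding factors_def by blast
  have lb: "length b = n" using b by (auto simp: factors_def)
  have a: "a = map (\<lambda>i. w (k + int i)) [0..<n]" and l: "last b = w (k + int n)"
    using k by auto
  have "b = map (\<lambda>i. w (k + 1 + int i)) [0..<n]"
  proof (rule nth_equalityI)
    fix i assume i: "i < length b"
    show "b ! i = map (\<lambda>i. w (k + 1 + int i)) [0..<n] ! i"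
    proof (cases "Suc i < n")
      case True
      then have "a ! Suc i = b ! i" using ab by force
      then show ?thesis using True by (simp add: a algebra_simps)
    next
      case False
      then have "n = Suc i" using i lb by simp
      then show ?thesis using l lb
        by (cases "b = []") (simp_all add: last_conv_nth algebra_simps nth_append)
    qed
  qed (simp add: lb)
  then show "e \<in> ?R" using e a by blast
next
  fix e assume "e \<in> ?R"
  then obtain k where e: "e = (map (\<lambda>i. w (k + int i)) [0..<n],
    map (\<lambda>i. w (k + 1 + int i)) [0..<n])" by blast
  have "last (map (\<lambda>i. w (k + 1 + int i)) [0..<n]) = w (k + int n)"
    using assms by (simp add: last_map last_conv_nth of_nat_diff)
  then have "map (\<lambda>i. w (k + int i)) [0..<n] @ [last (map (\<lambda>i. w (k + 1 + int i)) [0..<n])] =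
    map (\<lambda>i. w (k + int i)) [0..<Suc n]" by simp
  then show "e \<in> rauzy_edges w n"
    unfolding e rauzy_edges_def factors_def by (auto simp: of_nat_diff)
qed

lemma rauzy_edge_from:
  assumes "n \<ge> 1" "a \<in> factors w n"
  shows "\<exists>b. (a, b) \<in> rauzy_edges w n"
  using assms by (auto simp: rauzy_edges_eq factors_def)

lemma rauzy_vmap_factor:
  "rauzy_vmap n (map (\<lambda>i. w (k + int i)) [0..<Suc n]) =
    map (\<lambda>i. w ((if even n then k else k + 1) + int i)) [0..<n]"
  by (auto simp: rauzy_vmap_def map_tl [symmetric] algebra_simps
      simp del: upt_Suc intro!: nth_equalityI simp: nth_butlast nth_tl)

lemma rauzy_emap_edge:
  assumes "n \<ge> 1" "e \<in> rauzy_edges w (Suc n)"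
  shows "fst (rauzy_emap n (e, t)) \<in> rauzy_edges w n"
proof -
  obtain k where "e = (map (\<lambda>i. w (k + int i)) [0..<Suc n], map (\<lambda>i. w (k + 1 + int i)) [0..<Suc n])"
    using assms(2) by (auto simp: rauzy_edges_eq simp del: upt_Suc)
  then show ?thesis
    using assms(1)
    by (auto simp: rauzy_emap_def rauzy_vmap_factor rauzy_edges_eq simp del: upt_Suc
        intro: exI[of _ k] exI[of _ "k + 1"])
qed

lemma rauzy_map_eq_class:
  assumes "n \<ge> 1"
  shows "rauzy_map w n (eq_class (rauzy_glue w (Suc n)) p) =
    eq_class (rauzy_glue w n) (rauzy_emap n p)"
proof -
  have "equivclp (rauzy_glue w n) (rauzy_emap n p) (rauzy_emap n q)"
    if "equivclp (rauzy_glue w (Suc n)) p q" for q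
    using that
  proof (rule equivclp_respects)
    fix x y assume xy: "rauzy_glue w (Suc n) x y"
    have "rauzy_glue w n (rauzy_emap n x) (rauzy_emap n y)"
      using xy rauzy_emap_edge[OF assms, of "fst x" w "snd x"]
        rauzy_emap_edge[OF assms, of "fst y" w "snd y"]
      by (auto simp: rauzy_glue_def edge_end_def rauzy_emap_def split: prod.splits)
    then show "equivclp (rauzy_glue w n) (rauzy_emap n x) (rauzy_emap n y)"
      by (rule r_into_equivclp)
  qed
  then have "eq_class (rauzy_glue w n) (rauzy_emap n q) = eq_class (rauzy_glue w n) (rauzy_emap n p)"
    if "q \<in> eq_class (rauzy_glue w (Suc n)) p" for q
    using that by (metis eq_class_eq_iff eq_class_def mem_Collect_eq)
  moreover have "p \<in> eq_class (rauzy_glue w (Suc n)) p" by (simp add: eq_class_def)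
  ultimately show ?thesis unfolding rauzy_map_def by blast
qed

lemma continuous_map_rauzy_map:
  assumes "n \<ge> 1"
  shows "continuous_map (rauzy_space w (Suc n)) (rauzy_space w n) (rauzy_map w n)"
proof -
  let ?S = "\<lambda>n. sum_topology (\<lambda>_. top_of_set {0..1::real}) (rauzy_edges w n)"
  have "continuous_map (?S (Suc n)) (?S n) (rauzy_emap n)"
    unfolding continuous_map_def
  proof (intro conjI allI impI)
    show "rauzy_emap n \<in> topspace (?S (Suc n)) \<rightarrow> topspace (?S n)"
      using rauzy_emap_edge[OF assms] by (fastforce simp: rauzy_emap_def)
  next
    fix U assume U: "openin (?S n) U"
    have "openin (top_of_set {0..1}) {t. (e, t) \<in> {x \<in> topspace (?S (Suc n)). rauzy_emap n x \<in> U}}"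
      if e: "e \<in> rauzy_edges w (Suc n)" for e
    proof -
      define e' where "e' = fst (rauzy_emap n (e, 0))"
      have em: "rauzy_emap n (e, t) = (e', t)" for t
        by (simp add: e'_def rauzy_emap_def split: prod.splits)
      have o: "openin (top_of_set {0..1}) {t. (e', t) \<in> U}"
        using U rauzy_emap_edge[OF assms e, of 0] by (simp add: openin_sum_topology e'_def)
      moreover have "{t. (e, t) \<in> {x \<in> topspace (?S (Suc n)). rauzy_emap n x \<in> U}} =
          {t. (e', t) \<in> U}"
        using openin_subset[OF o] e by (auto simp: em)
      ultimately show ?thesis by simp
    qed
    then show "openin (?S (Suc n)) {x \<in> topspace (?S (Suc n)). rauzy_emap n x \<in> U}"
      unfolding openin_sum_topology[of _ _ "Collect _"] by auto
  qed
  then have "continuous_map (?S (Suc n)) (rauzy_space w n)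
      (eq_class (rauzy_glue w n) \<circ> rauzy_emap n)"
    unfolding rauzy_space_def
    by (rule continuous_map_compose) (rule quotient_imp_continuous_map[OF quotient_map_eq_class])
  moreover have "rauzy_map w n \<circ> eq_class (rauzy_glue w (Suc n)) =
      eq_class (rauzy_glue w n) \<circ> rauzy_emap n"
    by (intro ext) (simp add: rauzy_map_eq_class[OF assms])
  ultimately show ?thesis
    unfolding rauzy_space_def[of w "Suc n"]
    using continuous_compose_quotient_map[OF quotient_map_eq_class] by metis
qed


section \<open>Inverse limits of sequences\<close>

text \<open>The index set is \<open>{1, 2, \<dots>}\<close>; the space with index 0 is not used.\<close>

definition inverse_limit :: "(nat \<Rightarrow> 'a topology) \<Rightarrow> (nat \<Rightarrow> 'a \<Rightarrow> 'a) \<Rightarrow> (nat \<Rightarrow> 'a) topology" where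
  "inverse_limit X g = subtopology (product_topology X {1..})
      {x. \<forall>n\<ge>1. g n (x (Suc n)) = x n}"

end

theory Submission
  imports Defs
begin

text \<open>A point \<open>(x, t)\<close> of the suspension is sent to the sequence of positions at time \<open>t\<close> in the
  walks which \<open>x\<close> describes on the Rauzy graphs.  The map \<open>\<gamma>\<^sub>n\<close> shortens words alternately at either
  end, so the window of length \<open>n\<close> has to start \<open>n div 2\<close> places to the left of \<open>\<lfloor>t\<rfloor>\<close>; the windows then
  exhaust \<open>x\<close>, which gives injectivity.  The suspension is compact and the inverse limit is
  Hausdorff, so it remains to see that the map is onto.  Every point of \<open>R\<^sub>n\<close> is attained on the
  orbit of \<open>w\<close>; for a point \<open>z\<close> of the inverse limit, the fibres over its coordinates are thus
  nested nonempty closed subsets of a compact space, and they have a common point.\<close>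

section \<open>Words and windows\<close>

definition window :: "(int \<Rightarrow> 'a) \<Rightarrow> int \<Rightarrow> nat \<Rightarrow> 'a list" where
  "window x k n = map (\<lambda>i. x (k + int i)) [0..<n]"

definition window_edge :: "(int \<Rightarrow> 'a) \<Rightarrow> int \<Rightarrow> nat \<Rightarrow> 'a list \<times> 'a list" where
  "window_edge x k n = (window x k n, window x (k + 1) n)"

lemma window_eq_iff: "window x k n = window y j n \<longleftrightarrow> (\<forall>i<n. x (k + int i) = y (j + int i))"
  by (auto simp: window_def)

text \<open>The two ends of \<open>window_edge x k n\<close> are the prefix and the suffix of length
  \<open>n\<close> of the word of length \<open>n + 1\<close> at \<open>k\<close>.\<close>

lemma window_Suc_eqD:
  assumes "window x k (Suc n) = window y j (Suc n)"
  shows "window_edge x k n = window_edge y j n"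
proof -
  have "x (k + int i) = y (j + int i)" if "i \<le> n" for i
    using assms that by (simp add: window_eq_iff)
  from this this[of "Suc i" for i] show ?thesis
    by (simp add: window_edge_def window_eq_iff add.assoc)
qed

lemma factors_eq_windows: "factors w n = range (\<lambda>k. window w k n)"
  by (auto simp: factors_def window_def)

lemma rauzy_edges_eq_windows: "n \<ge> 1 \<Longrightarrow> rauzy_edges w n = range (\<lambda>k. window_edge w k n)"
  by (auto simp: rauzy_edges_eq window_edge_def window_def)

lemma finite_rauzy_edges:
  assumes "finite A" "range w \<subseteq> A"
  shows "finite (rauzy_edges w n)"
proof (rule finite_subset)
  have "factors w n \<subseteq> {xs. set xs \<subseteq> A \<and> length xs = n}"
    using assms(2) by (fastforce simp: factors_def)
  then have "finite (factors w n)"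
    by (rule finite_subset) (rule finite_lists_length_eq[OF assms(1)])
  then show "finite (factors w n \<times> factors w n)" by simp
qed (auto simp: rauzy_edges_def)

text \<open>Dropping the last letter keeps the start of a window, and dropping the first moves it
  one place to the right; an edge moves as its two ends do.\<close>

lemma rauzy_emap_window_edge:
  "rauzy_emap n (window_edge x k (Suc n), t) =
     (window_edge x (if even n then k else k + 1) n, t)"
  using rauzy_vmap_factor[of n x k] rauzy_vmap_factor[of n x "k + 1"]
  by (auto simp: rauzy_emap_def window_edge_def window_def simp del: upt_Suc)

text \<open>A window reads only finitely many coordinates, so it is locally constant.\<close>

lemma continuous_map_window:
  "continuous_map (full_shift A) (discrete_topology UNIV) (\<lambda>x. window x k n)"
  unfolding continuous_map_def
proof (intro conjI allI impI)
  fix S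
  show "openin (full_shift A) {x \<in> topspace (full_shift A). window x k n \<in> S}"
  proof (subst openin_subopen, safe)
    fix x assume x: "x \<in> topspace (full_shift A)" "window x k n \<in> S"
    let ?V = "\<lambda>i. {y \<in> topspace (full_shift A). y (k + int i) \<in> {x (k + int i)}}"
    let ?T = "topspace (full_shift A) \<inter> (\<Inter>i<n. ?V i)"
    have "openin (full_shift A) (?V i)" for i
    proof (rule openin_continuous_map_preimage)
      show "continuous_map (full_shift A) (discrete_topology A) (\<lambda>y. y (k + int i))"
        unfolding full_shift_def by (rule continuous_map_product_projection) simp
      show "openin (discrete_topology A) {x (k + int i)}"
        using x(1) by (auto simp: full_shift_def)
    qed
    \<comment> \<open>For \<open>n = 0\<close> the intersection over the empty family is
      \<open>UNIV\<close>, so \<open>?T\<close> is the whole space.\<close>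
    then have "openin (full_shift A) ?T"
      by (cases "n = 0") (auto intro!: openin_Int openin_Inter)
    moreover have "x \<in> ?T" using x by auto
    moreover have "window y k n = window x k n" if "y \<in> ?T" for y
      using that by (auto simp: window_eq_iff)
    then have "?T \<subseteq> {x \<in> topspace (full_shift A). window x k n \<in> S}"
      using x(2) by auto
    ultimately show "\<exists>T. openin (full_shift A) T \<and> x \<in> T \<and>
        T \<subseteq> {x \<in> topspace (full_shift A). window x k n \<in> S}" by blast
  qed
qed auto

text \<open>The points that share the window of \<open>x\<close> at \<open>k\<close> form an open
  neighbourhood of \<open>x\<close>, which must meet the orbit of \<open>w\<close>.\<close>

lemma window_in_factors:
  assumes "x \<in> topspace (subshift A w)"
  shows "window x k n \<in> factors w n"
proof -
  let ?T = "{y \<in> topspace (full_shift A). window y k n \<in> {window x k n}}"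
  have "openin (full_shift A) ?T"
    using continuous_map_window by (rule openin_continuous_map_preimage) simp
  moreover have "x \<in> ?T"
    using assms by (simp add: topspace_subshift in_closure_of)
  moreover have "\<forall>T. x \<in> T \<and> openin (full_shift A) T \<longrightarrow>
      (\<exists>y. y \<in> {shift_power n w | n. True} \<and> y \<in> T)"
    using assms unfolding topspace_subshift in_closure_of by (rule conjunct2)
  ultimately have "\<exists>y. y \<in> {shift_power n w | n. True} \<and> y \<in> ?T" by (simp del: mem_Collect_eq)
  then obtain m where "shift_power m w \<in> ?T" by fastforce
  then have "window w (k + m) n = window x k n"
    by (simp add: window_eq_iff shift_power_def algebra_simps)
  then show ?thesis unfolding factors_eq_windows by (metis rangeI)
qed

lemma window_edge_in_rauzy_edges:
  assumes "x \<in> topspace (subshift A w)" "n \<ge> 1"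
  shows "window_edge x k n \<in> rauzy_edges w n"
proof -
  \<comment> \<open>Length \<open>n + 1\<close> matters: that both ends are factors of
    \<open>w\<close> does not yet make them consecutive in \<open>w\<close>.\<close>
  obtain j where "window x k (Suc n) = window w j (Suc n)"
    using window_in_factors[OF assms(1), of k "Suc n"] by (auto simp: factors_eq_windows)
  then have "window_edge x k n = window_edge w j n" by (rule window_Suc_eqD)
  then show ?thesis using assms(2) by (simp add: rauzy_edges_eq_windows)
qed

section \<open>Compactness and shift invariance of the subshift\<close>

lemma compact_space_subshift:
  assumes "finite A"
  shows "compact_space (subshift A w)"
proof -
  have "compact_space (full_shift A)"
    unfolding full_shift_def using assms
    by (simp add: compact_space_product_topology compact_space_discrete_topology)
  then show ?thesis
    unfolding subshift_def by (intro compact_space_subtopology closedin_compact_space) auto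
qed

lemma word_in_subshift:
  assumes "range w \<subseteq> A"
  shows "w \<in> topspace (subshift A w)"
proof -
  have "{shift_power n w |n. True} \<subseteq> topspace (full_shift A)"
    using assms by (auto simp: full_shift_def shift_power_def)
  then have "{shift_power n w |n. True} \<subseteq> topspace (subshift A w)"
    unfolding topspace_subshift by (rule closure_of_subset)
  moreover have "w = shift_power 0 w" by (simp add: shift_power_def)
  ultimately show ?thesis by blast
qed

lemma shift_in_subshift:
  "x \<in> topspace (subshift A w) \<Longrightarrow> shift x \<in> topspace (subshift A w)"
  "x \<in> topspace (subshift A w) \<Longrightarrow> shift_power (- 1) x \<in> topspace (subshift A w)"
  using homeomorphic_maps_shift_subshift[of A w]
  by (auto simp: homeomorphic_maps_def dest!: continuous_map_funspace)

section \<open>Rauzy graphs as topological spaces\<close>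

lemma equivclp_invariant:
  assumes "equivclp r p q" "\<And>p q. r p q \<Longrightarrow> h p = h q"
  shows "h p = h q"
  using assms(1) by (induction rule: equivclp_induct) (auto dest: assms(2))

lemma quotient_space_lift:
  assumes h: "continuous_map X Z h" and inv: "\<And>p q. r p q \<Longrightarrow> h p = h q"
  shows "\<exists>g. continuous_map (quotient_space X r) Z g \<and> (\<forall>p\<in>topspace X. g (eq_class r p) = h p)"
proof (rule quotient_map_lift_exists[OF quotient_map_eq_class[of X r] h])
  show "h p = h q" if "eq_class r p = eq_class r q" for p q
    using that inv unfolding eq_class_eq_iff by (rule equivclp_invariant)
qed blast

text \<open>An inner point of an edge is glued to no other point, while edges with a common source
  share their point at parameter 0. The source is thus recovered in every case, and this suffices
  for injectivity.\<close>

lemma rauzy_glue_parameters: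
  assumes "equivclp (rauzy_glue w n) (e, t) (e', t')" "t \<noteq> 1" "t' \<noteq> 1"
  shows "t = t' \<and> fst e = fst e'"
proof -
  \<comment> \<open>\<open>h\<close> rewrites the end 1 of an edge as its target at parameter 0 and
    forgets the target elsewhere, so glued points get equal values.\<close>
  define h :: "('a list \<times> 'a list) \<times> real \<Rightarrow> 'a list \<times> real" where
    "h p = (if snd p = 1 then (snd (fst p), 0) else (fst (fst p), snd p))" for p
  have "h (e, t) = h (e', t')"
    using assms(1) by (rule equivclp_invariant) (auto simp: rauzy_glue_def edge_end_def h_def)
  then show ?thesis using assms(2,3) by (simp add: h_def)
qed

lemma continuous_map_rauzy_space_lift:
  fixes h :: "('a list \<times> 'a list) \<times> real \<Rightarrow> real"
  assumes "\<And>e. e \<in> rauzy_edges w n \<Longrightarrow> continuous_on {0..1} (\<lambda>t. h (e, t))"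
    and glue: "\<And>p q. rauzy_glue w n p q \<Longrightarrow> h p = h q"
  obtains g where "continuous_map (rauzy_space w n) euclideanreal g"
    "\<forall>e\<in>rauzy_edges w n. \<forall>t\<in>{0..1}. g (eq_class (rauzy_glue w n) (e, t)) = h (e, t)"
proof -
  let ?S = "sum_topology (\<lambda>_. top_of_set {0..1::real}) (rauzy_edges w n)"
  have "continuous_map ?S euclideanreal h"
    unfolding continuous_map_def openin_sum_topology
  proof (intro conjI allI impI ballI)
    fix U :: "real set" and e assume U: "openin euclideanreal U" and e: "e \<in> rauzy_edges w n"
    have "continuous_map (top_of_set {0..1}) euclideanreal (\<lambda>t. h (e, t))"
      using assms(1)[OF e] by simp
    then have "openin (top_of_set {0..1}) {t \<in> topspace (top_of_set {0..1}). h (e, t) \<in> U}"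
      using U by (rule openin_continuous_map_preimage)
    moreover have "{t. (e, t) \<in> {p \<in> topspace ?S. h p \<in> U}} =
        {t \<in> topspace (top_of_set {0..1}). h (e, t) \<in> U}"
      using e by auto
    ultimately show "openin (top_of_set {0..1}) {t. (e, t) \<in> {p \<in> topspace ?S. h p \<in> U}}"
      by simp
  qed auto
  from quotient_space_lift[OF this, of "rauzy_glue w n"] glue
  obtain g where "continuous_map (rauzy_space w n) euclideanreal g"
    and "\<forall>p\<in>topspace ?S. g (eq_class (rauzy_glue w n) p) = h p"
    unfolding rauzy_space_def by blast
  then show ?thesis using that by auto
qed

section \<open>The Hausdorff property of Rauzy graphs\<close>

lemma Hausdorff_space_separating_functions:
  assumes "\<And>x y. x \<in> topspace X \<Longrightarrow> y \<in> topspace X \<Longrightarrow> x \<noteq> y \<Longrightarrow>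
    \<exists>f. continuous_map X euclideanreal f \<and> f x \<noteq> f y"
  shows "Hausdorff_space X"
  unfolding Hausdorff_space_def
proof clarify
  fix x y assume xy: "x \<in> topspace X" "y \<in> topspace X" "x \<noteq> y"
  from assms[OF xy] obtain f where f: "continuous_map X euclideanreal f" "f x \<noteq> f y" by blast
  then obtain U V where UV: "open U" "open V" "f x \<in> U" "f y \<in> V" "U \<inter> V = {}"
    using hausdorff[OF f(2)] by blast
  have "openin X {z \<in> topspace X. f z \<in> U}" "openin X {z \<in> topspace X. f z \<in> V}"
    using UV f(1) by (auto intro!: openin_continuous_map_preimage)
  then show "\<exists>U V. openin X U \<and> openin X V \<and> x \<in> U \<and> y \<in> V \<and> disjnt U V"
    using xy UV by (intro exI[of _ "{z \<in> topspace X. f z \<in> U}"] exI[of _ "{z \<in> topspace X. f z \<in> V}"])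
      (auto simp: disjnt_def)
qed

text \<open>The separating function is 1 exactly at the vertex \<open>v\<close>. It respects the
  gluing, since at an end of an edge its value depends only on whether the vertex there is
  \<open>v\<close>.\<close>

lemma rauzy_separate_vertex:
  assumes "e' \<in> rauzy_edges w n" "t' \<in> {0..1}" "e \<in> rauzy_edges w n" "t \<in> {0..1}"
    and v: "edge_end e t v"
    and ne: "eq_class (rauzy_glue w n) (e, t) \<noteq> eq_class (rauzy_glue w n) (e', t')"
  shows "\<exists>g. continuous_map (rauzy_space w n) euclideanreal g \<and>
    g (eq_class (rauzy_glue w n) (e, t)) \<noteq> g (eq_class (rauzy_glue w n) (e', t'))"
proof -
  \<comment> \<open>squares, so that the value 1 is attained only at \<open>v\<close> even on a loop at \<open>v\<close>\<close>
  define h :: "('a list \<times> 'a list) \<times> real \<Rightarrow> real" where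
    "h p = (if fst (fst p) = v then (1 - snd p)\<^sup>2 else 0) + (if snd (fst p) = v then (snd p)\<^sup>2 else 0)"
    for p
  have "continuous_on {0..1} (\<lambda>t. h (e, t))" for e
    unfolding h_def by (cases "fst e = v"; cases "snd e = v") (auto intro!: continuous_intros)
  moreover have "h p = h q" if "rauzy_glue w n p q" for p q
    using that by (auto simp: rauzy_glue_def edge_end_def h_def)
  ultimately obtain g where g: "continuous_map (rauzy_space w n) euclideanreal g"
    "\<forall>e\<in>rauzy_edges w n. \<forall>t\<in>{0..1}. g (eq_class (rauzy_glue w n) (e, t)) = h (e, t)"
    by (rule continuous_map_rauzy_space_lift) blast
  have "\<not> rauzy_glue w n (e, t) (e', t')"
    using ne by (auto simp: eq_class_eq_iff)
  then have n': "\<not> edge_end e' t' v"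
    using v assms(1,3) by (auto simp: rauzy_glue_def)
  have "h (e', t') \<noteq> 1"
  proof
    assume h1: "h (e', t') = 1"
    \<comment> \<open>These bounds settle edges with one end at \<open>v\<close>; the identity that
      follows settles loops.\<close>
    have "t'\<^sup>2 \<le> t'" "(1 - t')\<^sup>2 \<le> 1 - t'"
      using assms(2) by (simp_all add: power2_eq_square mult_left_le)
    moreover have "(1 - t')\<^sup>2 + t'\<^sup>2 = 1 - 2 * (t' * (1 - t'))"
      by (simp add: power2_eq_square algebra_simps)
    ultimately have "t' = 0 \<and> fst e' = v \<or> t' = 1 \<and> snd e' = v"
      using h1 assms(2) by (auto simp: h_def split: if_splits)
    then show False using n' by (auto simp: edge_end_def)
  qed
  moreover have "h (e, t) = 1"
    using v by (auto simp: edge_end_def h_def)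
  ultimately show ?thesis using g assms by (metis (no_types))
qed

text \<open>The separating function is a tent on \<open>e\<close> with its peak at \<open>t\<close>.
  Its radius, the distance from \<open>t\<close> to the nearer end, makes it vanish at both ends, so
  that it respects the gluing.\<close>

lemma rauzy_separate_interior:
  assumes "e' \<in> rauzy_edges w n" "t' \<in> {0..1}" "e \<in> rauzy_edges w n" "0 < t" "t < 1"
    and ne: "(e, t) \<noteq> (e', t')"
  shows "\<exists>g. continuous_map (rauzy_space w n) euclideanreal g \<and>
    g (eq_class (rauzy_glue w n) (e, t)) \<noteq> g (eq_class (rauzy_glue w n) (e', t'))"
proof -
  define \<delta> where "\<delta> = min t (1 - t)"
  define h :: "('a list \<times> 'a list) \<times> real \<Rightarrow> real" where
    "h p = (if fst p = e then max 0 (\<delta> - \<bar>snd p - t\<bar>) else 0)" for p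
  have "continuous_on {0..1} (\<lambda>t. h (d, t))" for d
    by (cases "d = e") (auto simp: h_def intro!: continuous_intros)
  moreover have "h p = h q" if "rauzy_glue w n p q" for p q
    using that assms(4,5) by (auto simp: rauzy_glue_def edge_end_def h_def \<delta>_def)
  ultimately obtain g where g: "continuous_map (rauzy_space w n) euclideanreal g"
    "\<forall>e\<in>rauzy_edges w n. \<forall>t\<in>{0..1}. g (eq_class (rauzy_glue w n) (e, t)) = h (e, t)"
    by (rule continuous_map_rauzy_space_lift) blast
  have "h (e, t) \<noteq> h (e', t')"
    using assms(4,5) ne by (auto simp: h_def \<delta>_def)
  then show ?thesis using g assms by (metis atLeastAtMost_iff less_imp_le)
qed

lemma topspace_rauzy_space:
  "topspace (rauzy_space w n) = eq_class (rauzy_glue w n) ` (rauzy_edges w n \<times> {0..1})"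
  by (simp add: rauzy_space_def)

lemma Hausdorff_rauzy_space: "Hausdorff_space (rauzy_space w n)"
proof (rule Hausdorff_space_separating_functions)
  fix x y assume "x \<in> topspace (rauzy_space w n)" "y \<in> topspace (rauzy_space w n)"
    and "x \<noteq> y"
  then obtain e t e' t' where x: "x = eq_class (rauzy_glue w n) (e, t)"
      "e \<in> rauzy_edges w n" "t \<in> {0..1}"
    and y: "y = eq_class (rauzy_glue w n) (e', t')" "e' \<in> rauzy_edges w n" "t' \<in> {0..1}"
    unfolding topspace_rauzy_space by blast
  show "\<exists>f. continuous_map (rauzy_space w n) euclideanreal f \<and> f x \<noteq> f y"
  \<comment> \<open>Only the place of \<open>x\<close> decides the case; \<open>y\<close> may be any
    other point of the graph.\<close>
  proof (cases "t = 0 \<or> t = 1")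
    case True
    then obtain v where "edge_end e t v" by (auto simp: edge_end_def)
    then show ?thesis
      using rauzy_separate_vertex[OF y(2,3) x(2,3)] \<open>x \<noteq> y\<close> x(1) y(1) by blast
  next
    case False
    then show ?thesis
      using rauzy_separate_interior[OF y(2,3) x(2), of t] x y \<open>x \<noteq> y\<close> by auto
  qed
qed

section \<open>The coordinates of the homeomorphism\<close>

definition rauzy_coord :: "(int \<Rightarrow> 'a) \<Rightarrow> nat \<Rightarrow> (int \<Rightarrow> 'a) \<times> real \<Rightarrow>
    (('a list \<times> 'a list) \<times> real) set" where
  "rauzy_coord w n = (\<lambda>(x, t).
     eq_class (rauzy_glue w n) (window_edge x (\<lfloor>t\<rfloor> - int (n div 2)) n, frac t))"

text \<open>At \<open>t = k + 1\<close> the floor jumps to the next edge at parameter 0, which is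
  glued to the end of the current one. Closed time intervals are thus allowed, as pasting over
  closed sets requires.\<close>

lemma rauzy_coord_eq:
  assumes "x \<in> topspace (subshift A w)" "n \<ge> 1" "real_of_int k \<le> t" "t \<le> real_of_int k + 1"
  shows "rauzy_coord w n (x, t) =
    eq_class (rauzy_glue w n) (window_edge x (k - int (n div 2)) n, t - real_of_int k)"
proof (cases "t = real_of_int k + 1")
  case True
  have "rauzy_glue w n (window_edge x (k + 1 - int (n div 2)) n, 0)
      (window_edge x (k - int (n div 2)) n, 1)"
    using window_edge_in_rauzy_edges[OF assms(1,2)]
    by (auto simp: rauzy_glue_def edge_end_def) (simp add: window_edge_def algebra_simps)
  moreover have "\<lfloor>t\<rfloor> = k + 1" "frac t = 0" using True by (simp_all add: frac_def)
  ultimately show ?thesis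
    using True by (simp add: rauzy_coord_def eq_class_eq_iff r_into_equivclp)
next
  case False
  then have "\<lfloor>t\<rfloor> = k" using assms(3,4) by linarith
  then show ?thesis by (simp add: rauzy_coord_def frac_def)
qed

text \<open>From \<open>n\<close> to \<open>n + 1\<close> the start of the window moves left just
  when \<open>n\<close> is odd, which is when \<gamma> removes the first letter.\<close>

lemma rauzy_map_coord:
  assumes "n \<ge> 1"
  shows "rauzy_map w n (rauzy_coord w (Suc n) p) = rauzy_coord w n p"
proof -
  have "(if even n then k - int (Suc n div 2) else k - int (Suc n div 2) + 1) = k - int (n div 2)" for k
    by (cases "even n") simp_all
  then show ?thesis
    by (cases p) (simp add: rauzy_coord_def rauzy_map_eq_class[OF assms] rauzy_emap_window_edge)
qed

text \<open>Shifting the word and lowering the floor of the time by one cancel in the position of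
  the window.\<close>

lemma rauzy_coord_step:
  "suspension_step X shift p q \<Longrightarrow> rauzy_coord w n p = rauzy_coord w n q"
proof -
  have "window_edge (shift x) (\<lfloor>t - 1\<rfloor> - j) n = window_edge x (\<lfloor>t\<rfloor> - j) n"
    and "frac (t - 1) = frac t" for x :: "int \<Rightarrow> 'a" and t :: real and j
    by (simp_all add: window_edge_def window_def shift_def frac_def algebra_simps)
  then show "suspension_step X shift p q \<Longrightarrow> rauzy_coord w n p = rauzy_coord w n q"
    by (auto simp: suspension_step_def rauzy_coord_def)
qed

text \<open>Fix the edge \<open>e\<close> that \<open>x\<close> reads around \<open>k\<close> and
  keep \<open>t\<close> between \<open>k\<close> and \<open>k + 1\<close>: there the coordinate is
  the point of \<open>e\<close> at parameter \<open>t - k\<close>, which is continuous. A finite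
  alphabet gives finitely many edges, so these closed sets form a locally finite cover and the
  pieces can be pasted.\<close>

lemma continuous_map_rauzy_coord:
  assumes A: "finite A" "range w \<subseteq> A" and n: "n \<ge> 1"
  shows "continuous_map (prod_topology (subshift A w) euclideanreal) (rauzy_space w n) (rauzy_coord w n)"
proof -
  let ?X = "subshift A w" and ?P = "prod_topology (subshift A w) euclideanreal"
    and ?E = "rauzy_edges w n"
  let ?S = "sum_topology (\<lambda>_. top_of_set {0..1::real}) ?E"
  define C where "C k e = {x \<in> topspace ?X. window_edge x (k - int (n div 2)) n = e}" for k e
  define T where "T = (\<lambda>(k, e). C k e \<times> {real_of_int k..real_of_int k + 1})"
  define f where "f = (\<lambda>(k, e) (x :: int \<Rightarrow> 'a, t). eq_class (rauzy_glue w n) (e, t - real_of_int k))"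
  \<comment> \<open>Each piece is a restriction of \<open>rauzy_coord w n\<close>, so the pieces
    agree on overlaps.\<close>
  have eq: "f i p = rauzy_coord w n p" if "p \<in> T i" for i p
    using that n by (auto simp: T_def C_def f_def rauzy_coord_eq split: prod.splits)
  have cw: "continuous_map ?X (discrete_topology UNIV) (\<lambda>x. window x k n)" for k
    unfolding subshift_def by (rule continuous_map_from_subtopology[OF continuous_map_window])
  have clC: "closedin ?X (C k e)" for k e
  proof -
    have "C k e = {x \<in> topspace ?X. window x (k - int (n div 2)) n \<in> {fst e}} \<inter>
        {x \<in> topspace ?X. window x (k - int (n div 2) + 1) n \<in> {snd e}}"
      by (auto simp: C_def window_edge_def)
    also have "closedin ?X \<dots>"
      by (intro closedin_Int closedin_continuous_map_preimage[OF cw]) simp_all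
    finally show ?thesis .
  qed
  show ?thesis
  proof (rule pasting_lemma_locally_finite[where I = "UNIV \<times> ?E" and T = T and f = f])
    fix p assume p: "p \<in> topspace ?P"
    obtain x t where xt: "p = (x, t)" by (cases p)
    let ?V = "topspace ?X \<times> ball t 1"
    \<comment> \<open>A time interval of radius 1 meets only unit intervals whose index is within 2
      of the floor.\<close>
    have "\<lfloor>t\<rfloor> - 2 \<le> k \<and> k \<le> \<lfloor>t\<rfloor> + 2" if "real_of_int k \<le> s" "s \<le> real_of_int k + 1" "dist t s < 1" for k s
      using that unfolding dist_real_def by linarith
    then have "{i \<in> UNIV \<times> ?E. T i \<inter> ?V \<noteq> {}} \<subseteq> {\<lfloor>t\<rfloor> - 2..\<lfloor>t\<rfloor> + 2} \<times> ?E"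
      by (fastforce simp: T_def)
    then have "finite {i \<in> UNIV \<times> ?E. T i \<inter> ?V \<noteq> {}}"
      by (rule finite_subset) (simp add: finite_rauzy_edges[OF A])
    moreover have "openin ?P ?V" by (simp add: openin_prod_Times_iff)
    moreover have "p \<in> ?V" using p xt by simp
    ultimately show "\<exists>V. openin ?P V \<and> p \<in> V \<and> finite {i \<in> UNIV \<times> ?E. T i \<inter> V \<noteq> {}}"
      by blast
  next
    fix i show "closedin ?P (T i)"
      by (cases i) (simp add: T_def closedin_prod_Times_iff clC)
  next
    fix i :: "int \<times> 'a list \<times> 'a list" assume "i \<in> UNIV \<times> ?E"
    then obtain k e where i: "i = (k, e)" and e: "e \<in> ?E" by auto
    have "continuous_map (subtopology ?P (T i)) (top_of_set {0..1}) (\<lambda>p. snd p - real_of_int k)"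
      unfolding continuous_map_in_subtopology
      by (intro conjI continuous_map_from_subtopology continuous_intros continuous_map_snd)
         (auto simp: T_def i)
    then have "continuous_map (subtopology ?P (T i)) ?S (\<lambda>p. (e, snd p - real_of_int k))"
      using continuous_map_compose[OF _ continuous_map_component_injection[OF e]]
      by (fastforce simp: o_def)
    then have "continuous_map (subtopology ?P (T i)) (rauzy_space w n)
        (eq_class (rauzy_glue w n) \<circ> (\<lambda>p. (e, snd p - real_of_int k)))"
      unfolding rauzy_space_def
      by (rule continuous_map_compose) (rule quotient_imp_continuous_map[OF quotient_map_eq_class])
    then show "continuous_map (subtopology ?P (T i)) (rauzy_space w n) (f i)"
      by (simp add: f_def i o_def case_prod_unfold)
  next
    fix i j p assume "p \<in> topspace ?P \<inter> T i \<inter> T j"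
    then show "f i p = f j p" using eq by simp
  next
    fix p assume p: "p \<in> topspace ?P"
    obtain x t where xt: "p = (x, t)" "x \<in> topspace ?X" using p by auto
    let ?j = "(\<lfloor>t\<rfloor>, window_edge x (\<lfloor>t\<rfloor> - int (n div 2)) n)"
    have "p \<in> T ?j" using xt by (auto simp: T_def C_def intro: less_imp_le)
    moreover have "?j \<in> UNIV \<times> ?E" using window_edge_in_rauzy_edges[OF xt(2) n] by simp
    ultimately show "\<exists>j. j \<in> UNIV \<times> ?E \<and> p \<in> T j \<and> rauzy_coord w n p = f j p"
      using eq by metis
  qed
qed

section \<open>Representatives with time in [0,1), injectivity and compactness\<close>

text \<open>Following the generating relation \<open>k\<close> times, in either direction, changes
  \<open>t\<close> to \<open>t - k\<close>; with \<open>k\<close> the floor of \<open>t\<close> the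
  fractional part remains.\<close>

lemma suspension_representative:
  assumes "x \<in> topspace (subshift A w)"
  shows "\<exists>y\<in>topspace (subshift A w). \<exists>s. 0 \<le> s \<and> s < 1 \<and>
    equivclp (suspension_step (subshift A w) shift) (x, t) (y, s)"
proof -
  let ?X = "subshift A w"
  let ?R = "equivclp (suspension_step ?X shift)"
  have inv: "shift (shift_power (- 1) y) = y" for y :: "int \<Rightarrow> 'a"
    by (simp add: shift_def shift_power_def)
  have "\<exists>y\<in>topspace ?X. ?R (x, t) (y, t - real_of_int k)" for k
  proof (induction k rule: int_induct[where k = 0])
    case base
    show ?case using assms by (auto intro!: bexI[of _ x])
  next
    case (step1 k)
    then obtain y where y: "y \<in> topspace ?X" "?R (x, t) (y, t - real_of_int k)" by blast
    moreover have "?R (y, t - real_of_int k) (shift y, t - real_of_int (k + 1))"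
      using y(1) by (intro r_into_equivclp) (simp add: suspension_step_def)
    ultimately show ?case using shift_in_subshift(1) equivclp_trans by metis
  next
    case (step2 k)
    then obtain y where y: "y \<in> topspace ?X" "?R (x, t) (y, t - real_of_int k)" by blast
    moreover have "?R (shift_power (- 1) y, t - real_of_int (k - 1)) (y, t - real_of_int k)"
      using shift_in_subshift(2)[OF y(1)]
      by (intro r_into_equivclp) (simp add: suspension_step_def inv)
    ultimately show ?case using shift_in_subshift(2) equivclp_trans equivclp_sym by metis
  qed
  from this[of "\<lfloor>t\<rfloor>"] show ?thesis
    using frac_ge_0[of t] frac_lt_1[of t] unfolding frac_def by blast
qed

lemma rauzy_coord_inj:
  assumes "0 \<le> t" "t < 1" "0 \<le> s" "s < 1"
    and eq: "\<And>n. n \<ge> 1 \<Longrightarrow> rauzy_coord w n (x, t) = rauzy_coord w n (y, s)"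
  shows "(x, t) = (y, s)"
proof -
  have fl: "\<lfloor>t\<rfloor> = 0" "frac t = t" "\<lfloor>s\<rfloor> = 0" "frac s = s"
    using assms(1-4) by (auto simp: floor_eq_iff frac_eq)
  \<comment> \<open>Both parameters are below 1, as \<open>rauzy_glue_parameters\<close> requires;
    it yields equal times and equal sources.\<close>
  have *: "t = s \<and> window x (- int (n div 2)) n = window y (- int (n div 2)) n" if "n \<ge> 1" for n
    using eq[OF that] assms(2,4) fl
    by (auto simp: rauzy_coord_def eq_class_eq_iff window_edge_def dest!: rauzy_glue_parameters)
  have "x i = y i" for i
  proof -
    \<comment> \<open>The window of length \<open>2 * m\<close> covers the positions from
      \<open>- m\<close> to \<open>m - 1\<close>, so \<open>m\<close> has to exceed
      \<open>\<bar>i\<bar>\<close> to reach a positive \<open>i\<close>.\<close>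
    define m where "m = nat \<bar>i\<bar> + 1"
    have "window x (- int m) (2 * m) = window y (- int m) (2 * m)"
      using *[of "2 * m"] by (simp add: m_def)
    moreover have "nat (i + int m) < 2 * m" "i = - int m + int (nat (i + int m))"
      by (auto simp: m_def)
    ultimately show ?thesis unfolding window_eq_iff by metis
  qed
  then show ?thesis using * by auto
qed

text \<open>Every class has a representative with time in [0,1), so the suspension is a continuous
  image of the compact product of the subshift with \<open>{0..1}\<close>.\<close>

lemma compact_space_suspension:
  assumes "finite A"
  shows "compact_space (suspension (subshift A w) shift)"
proof -
  let ?X = "subshift A w"
  let ?P = "prod_topology ?X euclideanreal" and ?c = "eq_class (suspension_step ?X shift)"
  have "continuous_map ?P (suspension ?X shift) ?c"
    unfolding suspension_def by (rule quotient_imp_continuous_map[OF quotient_map_eq_class])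
  moreover have "compactin ?P (topspace ?X \<times> {0..1})"
    using compact_space_subshift[OF assms, of w]
    by (simp add: compactin_Times compact_space_def)
  ultimately have "compactin (suspension ?X shift) (?c ` (topspace ?X \<times> {0..1}))"
    by (rule image_compactin[rotated])
  moreover have "?c ` (topspace ?X \<times> {0..1}) = topspace (suspension ?X shift)"
  proof
    show "topspace (suspension ?X shift) \<subseteq> ?c ` (topspace ?X \<times> {0..1})"
    proof
      fix u assume "u \<in> topspace (suspension ?X shift)"
      then obtain x t where "u = ?c (x, t)" "x \<in> topspace ?X" by (auto simp: suspension_def)
      then show "u \<in> ?c ` (topspace ?X \<times> {0..1})"
        using suspension_representative[of x A w t]
        by (force simp: image_iff eq_class_eq_iff)
    qed
  qed (auto simp: suspension_def)
  ultimately show ?thesis by (simp add: compact_space_def)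
qed

section \<open>Surjectivity and the homeomorphism\<close>

lemma topspace_inverse_limit:
  "topspace (inverse_limit X g) =
     {z \<in> \<Pi>\<^sub>E n\<in>{1..}. topspace (X n). \<forall>n\<ge>1. g n (z (Suc n)) = z n}"
  by (auto simp: inverse_limit_def)

text \<open>Every edge is read in \<open>w\<close> at some position \<open>k\<close>, and at time
  \<open>k + n div 2\<close> the window of length \<open>n\<close> starts right there. Only a single
  coordinate is prescribed here.\<close>

lemma rauzy_coord_surj:
  assumes "range w \<subseteq> A" "n \<ge> 1" "z \<in> topspace (rauzy_space w n)"
  shows "\<exists>p. p \<in> topspace (prod_topology (subshift A w) euclideanreal) \<and> rauzy_coord w n p = z"
proof -
  obtain k t where z: "z = eq_class (rauzy_glue w n) (window_edge w k n, t)" "t \<in> {0..1}"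
    using assms(2,3) by (auto simp: topspace_rauzy_space rauzy_edges_eq_windows)
  have "rauzy_coord w n (w, t + real_of_int (k + int (n div 2))) = z"
    using rauzy_coord_eq[OF word_in_subshift[OF assms(1)] assms(2),
        of "k + int (n div 2)" "t + real_of_int (k + int (n div 2))"] z by simp
  then show ?thesis
    using word_in_subshift[OF assms(1)]
    by (intro exI[of _ "(w, t + real_of_int (k + int (n div 2)))"]) simp
qed

theorem theorem5p10:
  fixes A :: "'a set" and w :: "int \<Rightarrow> 'a"
  assumes "finite A" and "range w \<subseteq> A"
  shows "suspension (subshift A w) shift homeomorphic_space
         inverse_limit (rauzy_space w) (rauzy_map w)"
proof -
  let ?X = "subshift A w"
  let ?P = "prod_topology ?X euclideanreal" and ?c = "eq_class (suspension_step ?X shift)"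
    and ?S = "suspension ?X shift" and ?L = "inverse_limit (rauzy_space w) (rauzy_map w)"
  \<comment> \<open>Points of a product over \<open>{1..}\<close> are extensional, which the
    restriction ensures at index 0.\<close>
  define h where "h p = (\<lambda>n\<in>{1..}. rauzy_coord w n p)" for p
  have h: "h p n = rauzy_coord w n p" if "n \<ge> 1" for n p using that by (simp add: h_def)
  have "continuous_map ?P (product_topology (rauzy_space w) {1..}) h"
    unfolding continuous_map_componentwise
    by (auto simp: h_def continuous_map_rauzy_coord[OF assms])
  then have "continuous_map ?P ?L h"
    unfolding inverse_limit_def continuous_map_in_subtopology
    by (auto simp: h rauzy_map_coord)
  moreover have "h p = h q" if "suspension_step ?X shift p q" for p q
    using rauzy_coord_step[OF that] by (simp add: h_def)
  ultimately obtain g where g: "continuous_map ?S ?L g"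
    and gc: "\<forall>p\<in>topspace ?P. g (?c p) = h p"
    unfolding suspension_def using quotient_space_lift by metis
  have tS: "topspace ?S = ?c ` topspace ?P" by (simp add: suspension_def)
  have proj: "continuous_map ?S (rauzy_space w n) (\<lambda>u. g u n)" if "n \<ge> 1" for n
    using g that unfolding inverse_limit_def continuous_map_in_subtopology
    by (auto simp: continuous_map_componentwise)
  have "inj_on g (topspace ?S)"
  proof (rule inj_onI)
    fix u v assume "u \<in> topspace ?S" "v \<in> topspace ?S" and guv: "g u = g v"
    then obtain x t y s where u: "u = ?c (x, t)" "x \<in> topspace ?X"
      and v: "v = ?c (y, s)" "y \<in> topspace ?X" by (auto simp: tS)
    \<comment> \<open>Normalised representatives turn equality of classes into equality of
      pairs.\<close>
    obtain x' t' where xt: "u = ?c (x', t')" "x' \<in> topspace ?X" "0 \<le> t'" "t' < 1"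
      using suspension_representative[OF u(2), of t] u(1) by (auto simp: eq_class_eq_iff)
    obtain y' s' where ys: "v = ?c (y', s')" "y' \<in> topspace ?X" "0 \<le> s'" "s' < 1"
      using suspension_representative[OF v(2), of s] v(1) by (auto simp: eq_class_eq_iff)
    have "h (x', t') = h (y', s')" using guv xt ys gc by simp
    then have "(x', t') = (y', s')"
      using rauzy_coord_inj[of t' s' w x' y'] xt ys h by metis
    then show "u = v" using xt ys by simp
  qed
  moreover have "g ` topspace ?S = topspace ?L"
  proof
    show "g ` topspace ?S \<subseteq> topspace ?L"
      using g by (rule continuous_map_image_subset_topspace)
    show "topspace ?L \<subseteq> g ` topspace ?S"
    proof
      fix z assume "z \<in> topspace ?L"
      then have zE: "z \<in> (\<Pi>\<^sub>E n\<in>{1..}. topspace (rauzy_space w n))"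
        and zc: "\<And>n. n \<ge> 1 \<Longrightarrow> rauzy_map w n (z (Suc n)) = z n"
        by (auto simp: topspace_inverse_limit)
      have zt: "z (Suc m) \<in> topspace (rauzy_space w (Suc m))" for m using zE by auto
      \<comment> \<open>The nest is indexed from 0 and the coordinates from 1, hence
        \<open>Suc m\<close>.\<close>
      define C where "C m = {u \<in> topspace ?S. g u (Suc m) \<in> {z (Suc m)}}" for m
      have "(\<Inter>m. C m) \<noteq> {}"
      proof (rule compact_space_imp_nest[OF compact_space_suspension[OF assms(1)]])
        \<comment> \<open>Points of the Rauzy graphs are closed by the Hausdorff property.\<close>
        show "closedin ?S (C m)" for m
          unfolding C_def
          by (intro closedin_continuous_map_preimage[OF proj]
              closedin_Hausdorff_singleton[OF Hausdorff_rauzy_space zt]) simp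
        show "C m \<noteq> {}" for m
        proof -
          obtain p where p: "p \<in> topspace ?P" "rauzy_coord w (Suc m) p = z (Suc m)"
            using rauzy_coord_surj[OF assms(2) _ zt[of m]] by auto
          then have "g (?c p) (Suc m) = z (Suc m)" using gc[rule_format, OF p(1)] h by simp
          then have "?c p \<in> C m" unfolding C_def tS using p(1) by blast
          then show ?thesis by blast
        qed
        show "decseq C"
        proof (rule decseq_SucI, rule subsetI)
          fix m u assume u: "u \<in> C (Suc m)"
          then have "g u \<in> topspace ?L" using g by (auto simp: C_def continuous_map_def)
          \<comment> \<open>A coordinate determines the preceding one through \<gamma>, so agreement
            at \<open>m + 2\<close> implies agreement at \<open>m + 1\<close>.\<close>
          then have "g u (Suc m) = rauzy_map w (Suc m) (g u (Suc (Suc m)))"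
            by (simp add: topspace_inverse_limit)
          then show "u \<in> C m" using u zc[of "Suc m"] by (simp add: C_def)
        qed
      qed
      then obtain u where u: "u \<in> topspace ?S" "\<And>m. g u (Suc m) = z (Suc m)"
        by (auto simp: C_def)
      \<comment> \<open>Equality at index 0 comes from extensionality of both sequences.\<close>
      moreover have "g u \<in> (\<Pi>\<^sub>E n\<in>{1..}. topspace (rauzy_space w n))"
        using u(1) g by (auto simp: continuous_map_def topspace_inverse_limit)
      moreover have "g u n = z n" if "n \<in> {1..}" for n
        using that u(2)[of "n - 1"] by simp
      ultimately have "g u = z" using zE by (intro PiE_ext)
      then show "z \<in> g ` topspace ?S" using u(1) by blast
    qed
  qed
  moreover have "Hausdorff_space ?L"
    unfolding inverse_limit_def
    by (intro Hausdorff_space_subtopology)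
       (simp add: Hausdorff_space_product_topology Hausdorff_rauzy_space)
  ultimately have "homeomorphic_map ?S ?L g"
    using continuous_imp_homeomorphic_map[OF g compact_space_suspension[OF assms(1)]] by blast
  then show ?thesis by (rule homeomorphic_map_imp_homeomorphic_space)
qed

end
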